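(* Let $\mu$ be a probability distribution supported on $\Omega=\{\pm1\}^n$ and $\{q_i:\Omega\to\mathbb{R}_+\}_{i\in[n]}$ be transition rates reversible for $\mu$. Let $\{w_i:\Omega\to\mathbb{R}_+\}_{i\in[n]}$ be weight functions that are $b$-bounded for some $b\in(0,1]$. Suppose the reinforced Bakry–Émery condition (equivalently, the strong gradient estimate) holds with constant $\rho\in\mathbb{R}$. Then for any $f:\Omega\to[0,1]$ and $t\ge0$, pointwise on $\Omega$, $$\mathcal I(P_tf)\le P_t\left(\sqrt{\mathcal I(f)^2+\gamma(t)\,\Gamma_w(f)}\right),$$ where $\gamma(t)=\frac{2(1-e^{-2\rho t})}{b\rho}$ if $\rho\ne0$ and $\gamma(t)=\frac{4t}{b}$ if $\rho=0$, and $\mathcal I$ is the Gaussian isoperimetric profile.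
   Context: $x^i$ is $x\in\Omega$ with the $i$-th coordinate flipped. Generator: $Lf(x)=\sum_{i=1}^nq_i(x)(f(x^i)-f(x))$; $P_t=e^{tL}$. Reversible for $\mu$: $\mu(x)q_i(x)=\mu(x^i)q_i(x^i)$ for all $x,i$. $b$-bounded weights: $b\le w_i(x)\le1/b$ for all $x,i$. Carré du champ operators: $\Gamma_w(f,g)(x)=\frac12\sum_{i=1}^nw_i(x)q_i(x)(f(x^i)-f(x))(g(x^i)-g(x))$, $\Gamma_w(f)=\Gamma_w(f,f)$; $\Gamma$ is $\Gamma_w$ with $w\equiv1$. Iterated: $\Gamma_{2;w}(f)=\frac12L\Gamma_w(f)-\Gamma_w(f,Lf)$. Reinforced Bakry–Émery condition with constant $\rho$: $\Gamma_{2;w}(f)-\Gamma(\sqrt{\Gamma_w(f)})\ge\rho\,\Gamma_w(f)$ pointwise for all $f:\Omega\to\mathbb{R}$. Strong gradient estimate with constant $\rho$: $\sqrt{\Gamma_w(P_tf)}\le e^{-\rho t}P_t\sqrt{\Gamma_w(f)}$ pointwise for all $f:\Omega\to\mathbb{R}$, $t\ge0$. The two are equivalent. Gaussian isoperimetric profile: $\mathcal I(x)=\varphi(\Phi^{-1}(x))$ on $[0,1]$ ($\mathcal I(0)=\mathcal I(1)=0$), $\varphi,\Phi$ being the standard Gaussian density and distribution function. *)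

theory Defs
  imports "HOL-Probability.Probability"
begin

text \<open>
  The index set \<open>[n]\<close> is a finite type \<open>'n\<close>, so \<open>n = CARD('n)\<close>. The hypercube is a set of
  integer vectors; a function on it is a total function on \<open>int ^ 'n\<close> of which only the
  values on \<open>cube\<close> are ever used, since \<open>cube\<close> is closed under \<open>flip\<close>.
\<close>

definition cube :: "(int ^ 'n::finite) set" where
  "cube = {x. \<forall>i. x $ i = - 1 \<or> x $ i = 1}"

definition flip :: "'n::finite \<Rightarrow> int ^ 'n \<Rightarrow> int ^ 'n" where
  "flip i x = (\<chi> j. if j = i then - (x $ j) else x $ j)"

lemma flip_in_cube: "x \<in> cube \<Longrightarrow> flip i x \<in> cube"
  by (auto simp: cube_def flip_def)

definition generator ::
    "('n::finite \<Rightarrow> int ^ 'n \<Rightarrow> real) \<Rightarrow> (int ^ 'n \<Rightarrow> real) \<Rightarrow> int ^ 'n \<Rightarrow> real" where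
  "generator q f x = (\<Sum>i\<in>UNIV. q i x * (f (flip i x) - f x))"

text \<open>
  \<open>markov_semigroup q t\<close> is \<open>exp (t L)\<close> as the exponential series of the operator \<open>L = generator q\<close>,
  which is bounded because only finitely many states are involved.
\<close>

definition markov_semigroup ::
    "('n::finite \<Rightarrow> int ^ 'n \<Rightarrow> real) \<Rightarrow> real \<Rightarrow> (int ^ 'n \<Rightarrow> real) \<Rightarrow> int ^ 'n \<Rightarrow> real" where
  "markov_semigroup q t f x = (\<Sum>k. t ^ k / fact k * (generator q ^^ k) f x)"

definition reversible ::
    "(int ^ 'n::finite) pmf \<Rightarrow> ('n \<Rightarrow> int ^ 'n \<Rightarrow> real) \<Rightarrow> bool" where
  "reversible \<mu> q \<longleftrightarrow>
     (\<forall>x\<in>cube. \<forall>i. pmf \<mu> x * q i x = pmf \<mu> (flip i x) * q i (flip i x))"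

definition bounded_weights :: "real \<Rightarrow> ('n::finite \<Rightarrow> int ^ 'n \<Rightarrow> real) \<Rightarrow> bool" where
  "bounded_weights b w \<longleftrightarrow> (\<forall>x\<in>cube. \<forall>i. b \<le> w i x \<and> w i x \<le> 1 / b)"

definition carre_du_champ ::
    "('n::finite \<Rightarrow> int ^ 'n \<Rightarrow> real) \<Rightarrow> ('n \<Rightarrow> int ^ 'n \<Rightarrow> real) \<Rightarrow>
     (int ^ 'n \<Rightarrow> real) \<Rightarrow> (int ^ 'n \<Rightarrow> real) \<Rightarrow> int ^ 'n \<Rightarrow> real" where
  "carre_du_champ q w f g x =
     1 / 2 * (\<Sum>i\<in>UNIV. w i x * q i x * (f (flip i x) - f x) * (g (flip i x) - g x))"

definition Gamma_w ::
    "('n::finite \<Rightarrow> int ^ 'n \<Rightarrow> real) \<Rightarrow> ('n \<Rightarrow> int ^ 'n \<Rightarrow> real) \<Rightarrow>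
     (int ^ 'n \<Rightarrow> real) \<Rightarrow> int ^ 'n \<Rightarrow> real" where
  "Gamma_w q w f = carre_du_champ q w f f"

definition Gamma_unweighted ::
    "('n::finite \<Rightarrow> int ^ 'n \<Rightarrow> real) \<Rightarrow> (int ^ 'n \<Rightarrow> real) \<Rightarrow> int ^ 'n \<Rightarrow> real" where
  "Gamma_unweighted q f = Gamma_w q (\<lambda>i x. 1) f"

definition Gamma2_w ::
    "('n::finite \<Rightarrow> int ^ 'n \<Rightarrow> real) \<Rightarrow> ('n \<Rightarrow> int ^ 'n \<Rightarrow> real) \<Rightarrow>
     (int ^ 'n \<Rightarrow> real) \<Rightarrow> int ^ 'n \<Rightarrow> real" where
  "Gamma2_w q w f x =
     1 / 2 * generator q (Gamma_w q w f) x - carre_du_champ q w f (generator q f) x"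

definition reinforced_Bakry_Emery ::
    "('n::finite \<Rightarrow> int ^ 'n \<Rightarrow> real) \<Rightarrow> ('n \<Rightarrow> int ^ 'n \<Rightarrow> real) \<Rightarrow> real \<Rightarrow> bool" where
  "reinforced_Bakry_Emery q w \<rho> \<longleftrightarrow>
     (\<forall>f. \<forall>x\<in>cube.
        Gamma2_w q w f x - Gamma_unweighted q (\<lambda>y. sqrt (Gamma_w q w f y)) x
          \<ge> \<rho> * Gamma_w q w f x)"

definition std_normal_cdf :: "real \<Rightarrow> real" where
  "std_normal_cdf = cdf (density lborel std_normal_density)"

definition gaussian_profile :: "real \<Rightarrow> real" where
  "gaussian_profile x =
     (if 0 < x \<and> x < 1 then std_normal_density (inv std_normal_cdf x) else 0)"

definition gamma_coeff :: "real \<Rightarrow> real \<Rightarrow> real \<Rightarrow> real" where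
  "gamma_coeff b \<rho> t =
     (if \<rho> = 0 then 4 * t / b else 2 * (1 - exp (- 2 * \<rho> * t)) / (b * \<rho>))"

end

theory Submission
  imports Defs
begin

text \<open>
  The proof is a semigroup interpolation. With \<open>g\<^sub>s = P\<^sub>t\<^sub>-\<^sub>s f\<close> and
  \<open>F\<^sub>s = sqrt (\<I> (g\<^sub>s)\<^sup>2 + \<gamma> (s) \<Gamma>\<^sub>w g\<^sub>s)\<close>, the function \<open>s \<mapsto> P\<^sub>s F\<^sub>s\<close> joins the two sides of
  the inequality as \<open>s\<close> runs from \<open>0\<close> to \<open>t\<close>, and its derivative is \<open>P\<^sub>s (L F\<^sub>s + F\<^sub>s')\<close>. As \<open>P\<^sub>s\<close>
  preserves positivity, it suffices that \<open>L F\<^sub>s + F\<^sub>s' \<ge> 0\<close> pointwise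
  (\<open>interpolation_derivative_nonneg\<close>).

  On a diffusion the functions \<open>\<I> (g)\<close> and \<open>F\<close> would be differentiated by the chain rule, with
  \<open>\<I> \<I>'' = - 1\<close> as input. On the cube the chain rule fails, and two edgewise facts replace it. The
  triangle inequality in the plane, applied to the vector \<open>(\<I> (g), sqrt (\<gamma> \<Gamma>\<^sub>w g))\<close> whose length is
  \<open>F\<close>, bounds \<open>\<Gamma> F\<close> by the sum of a part cancelled by
  the expansion of \<open>L (\<I> (g)\<^sup>2)\<close> and the part \<open>\<gamma> \<Gamma> (sqrt (\<Gamma>\<^sub>w g))\<close> absorbed by the reinforced
  Bakry-Emery condition (\<open>Gamma_sqrt_sum_le\<close>). The inequality
  \<open>\<I> (a) (\<I> (c) - \<I> (a) - \<I>' (a) (c - a)) + (c - a)\<^sup>2 \<ge> 0\<close> for \<open>a, c\<close> in \<open>(0, 1)\<close> gives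
  \<open>\<I> (g) (L (\<I> (g)) - \<I>' (g) L g) \<ge> - 2 \<Gamma> g\<close> (\<open>gaussian_profile_two_point\<close>); the two-point inequality follows from
  \<open>\<I> \<I>'' = - 1\<close> and the concavity of \<open>\<I>\<close>. The lower bound \<open>w \<ge> b\<close> bounds \<open>\<Gamma> g\<close> by \<open>\<Gamma>\<^sub>w g / b\<close>, and what remains
  is the requirement \<open>\<gamma>' + 2 \<rho> \<gamma> \<ge> 4 / b\<close>, which \<open>\<gamma>\<close> satisfies with equality.

  All derivatives exist as long as \<open>f\<close> stays away from \<open>0\<close> and \<open>1\<close> (\<open>local_bobkov_interior\<close>). The
  general case follows by contracting \<open>f\<close> slightly towards \<open>1 / 2\<close>, since \<open>\<I>\<close> is continuous.
\<close>

section \<open>The Gaussian isoperimetric profile\<close>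

interpretation std_normal: real_distribution std_normal_distribution
  by (rule real_dist_normal_dist)

lemma std_normal_density_deriv:
  "(std_normal_density has_real_derivative - z * std_normal_density z) (at z)"
proof -
  have "((\<lambda>z. 1 / sqrt (2 * pi) * exp (- z\<^sup>2 / 2)) has_real_derivative
      1 / sqrt (2 * pi) * (exp (- z\<^sup>2 / 2) * - z)) (at z)"
    by (intro DERIV_cmult DERIV_fun_exp) (auto intro!: derivative_eq_intros)
  then show ?thesis
    by (simp add: std_normal_density_def[abs_def] mult_ac)
qed

lemma std_normal_cdf_deriv:
  "(std_normal_cdf has_real_derivative std_normal_density z) (at z)"
proof -
  define a where "a = z - 1"
  have cont: "continuous_on S std_normal_density" for S
    by (intro DERIV_continuous_on[OF DERIV_subset[OF std_normal_density_deriv]]) auto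
  have eq: "std_normal_cdf a + integral {a..x} std_normal_density = std_normal_cdf x"
    if "a < x" for x
  proof -
    have int: "set_integrable lborel {a<..x} std_normal_density"
      unfolding set_integrable_def by (intro integrable_mult_indicator) auto
    have "std_normal_cdf x - std_normal_cdf a = measure std_normal_distribution {a<..x}"
      unfolding std_normal_cdf_def using std_normal.cdf_diff_eq[OF that] .
    also have "\<dots> = (\<integral>y. indicator {a<..x} y \<partial>std_normal_distribution)"
      by simp
    also have "\<dots> = (LINT y:{a<..x}|lborel. std_normal_density y)"
      unfolding set_lebesgue_integral_def
      by (subst integral_density) (auto simp: mult.commute)
    also have "\<dots> = integral {a<..x} std_normal_density"
      by (rule set_borel_integral_eq_integral[OF int])
    also have "\<dots> = integral {a..x} std_normal_density"
      by (rule integral_subset_negligible) (auto intro: negligible_subset[OF negligible_sing[of a]])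
    finally show ?thesis by simp
  qed
  have "((\<lambda>x. std_normal_cdf a + integral {a..x} std_normal_density)
      has_real_derivative std_normal_density z) (at z within {a..z + 1})"
    using integral_has_real_derivative[OF cont, of z a "z + 1"]
    by (auto intro!: derivative_eq_intros simp: a_def)
  then have "((\<lambda>x. std_normal_cdf a + integral {a..x} std_normal_density)
      has_real_derivative std_normal_density z) (at z within {a<..<z + 1})"
    by (rule DERIV_subset) auto
  then have "(std_normal_cdf has_real_derivative std_normal_density z) (at z within {a<..<z + 1})"
    by (rule has_field_derivative_transform_within[where d = 1])
       (auto simp: a_def eq[unfolded a_def])
  then show ?thesis
    by (subst (asm) at_within_open) (auto simp: a_def)
qed

lemma std_normal_cdf_strict_mono: "strict_mono std_normal_cdf"
proof (rule strict_monoI)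
  fix x y :: real assume "x < y"
  then show "std_normal_cdf x < std_normal_cdf y"
    using std_normal_cdf_deriv normal_density_pos[of 1 0]
    by (intro DERIV_pos_imp_increasing[of x y std_normal_cdf]) force+
qed

lemma inv_std_normal_cdf_cdf [simp]: "inv std_normal_cdf (std_normal_cdf z) = z"
  by (intro inv_f_f strict_mono_imp_inj_on std_normal_cdf_strict_mono)

lemma std_normal_cdf_strictly_between: "0 < std_normal_cdf z" "std_normal_cdf z < 1"
proof -
  have "0 \<le> std_normal_cdf (z - 1)" "std_normal_cdf (z + 1) \<le> 1"
    unfolding std_normal_cdf_def by (auto intro: std_normal.cdf_nonneg std_normal.cdf_bounded_prob)
  moreover have "std_normal_cdf (z - 1) < std_normal_cdf z" "std_normal_cdf z < std_normal_cdf (z + 1)"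
    by (auto intro: strict_monoD[OF std_normal_cdf_strict_mono])
  ultimately show "0 < std_normal_cdf z" "std_normal_cdf z < 1" by linarith+
qed

text \<open>
  The distribution function is continuous and strictly increasing with limits \<open>0\<close> and \<open>1\<close>. Thus on
  \<open>(0, 1)\<close>, and only there, \<open>inv std_normal_cdf\<close> is a genuine two-sided inverse; this is the quantile
  function \<open>\<Phi>\<inverse>\<close> that appears below.
\<close>

lemma std_normal_cdf_onto:
  assumes "0 < x" "x < 1"
  obtains z where "std_normal_cdf z = x"
proof -
  have "eventually (\<lambda>z. x < std_normal_cdf z) at_top"
    unfolding std_normal_cdf_def using std_normal.cdf_lim_at_top_prob assms order_tendstoD(1) by blast
  then obtain u where u: "x < std_normal_cdf u" by (auto simp: eventually_at_top_linorder)
  have "eventually (\<lambda>z. std_normal_cdf z < x) at_bot"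
    unfolding std_normal_cdf_def using std_normal.cdf_lim_at_bot assms order_tendstoD(2) by blast
  then obtain l where l: "std_normal_cdf l < x" by (auto simp: eventually_at_bot_linorder)
  have "l < u" using l u strict_mono_less[OF std_normal_cdf_strict_mono] by force
  then obtain z where "std_normal_cdf z = x"
    using IVT[of std_normal_cdf l x u] l u DERIV_isCont[OF std_normal_cdf_deriv] by force
  then show ?thesis by (rule that)
qed

text \<open>
  The inverse function rule gives the derivative \<open>1 / \<phi> (\<Phi>\<inverse> x)\<close>, whose denominator is the profile
  itself. Together with the next derivative, \<open>\<I>' = - \<Phi>\<inverse>\<close>, this is the differential equation
  \<open>\<I> \<I>'' = - 1\<close>, the source of the concavity of the profile and of the two-point inequality.
\<close>

lemma inv_std_normal_cdf_deriv:
  assumes "0 < x" "x < 1"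
  shows "(inv std_normal_cdf has_real_derivative 1 / gaussian_profile x) (at x)"
proof -
  obtain z where z: "std_normal_cdf z = x" using std_normal_cdf_onto[OF assms] .
  have right_inv: "std_normal_cdf (inv std_normal_cdf y) = y" if "0 < y" "y < 1" for y
    using std_normal_cdf_onto[OF that] by (metis inv_std_normal_cdf_cdf)
  have "isCont (inv std_normal_cdf) (std_normal_cdf z)"
    by (rule isCont_inverse_function[where d = 1])
       (simp_all add: DERIV_isCont[OF std_normal_cdf_deriv])
  then have "(inv std_normal_cdf has_real_derivative inverse (std_normal_density z)) (at x)"
    using assms std_normal_cdf_deriv[of z] normal_density_pos[of 1 0 z]
    by (intro DERIV_inverse_function[where f = std_normal_cdf and a = 0 and b = 1])
       (auto simp: z[symmetric] right_inv)
  moreover have "gaussian_profile x = std_normal_density z"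
    using assms z by (auto simp: gaussian_profile_def)
  ultimately show ?thesis by (simp add: field_simps)
qed

lemma gaussian_profile_pos: "0 < x \<Longrightarrow> x < 1 \<Longrightarrow> 0 < gaussian_profile x"
  by (simp add: gaussian_profile_def normal_density_pos)

lemma gaussian_profile_nonneg: "0 \<le> gaussian_profile x"
  by (simp add: gaussian_profile_def)

lemma gaussian_profile_deriv:
  assumes "0 < x" "x < 1"
  shows "(gaussian_profile has_real_derivative - inv std_normal_cdf x) (at x)"
proof -
  have "((\<lambda>x. std_normal_density (inv std_normal_cdf x)) has_real_derivative
     (- inv std_normal_cdf x * std_normal_density (inv std_normal_cdf x)) * (1 / gaussian_profile x)) (at x)"
    by (rule DERIV_chain2[OF std_normal_density_deriv inv_std_normal_cdf_deriv[OF assms]])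
  moreover have "std_normal_density (inv std_normal_cdf x) = gaussian_profile x"
    using assms by (simp add: gaussian_profile_def)
  ultimately have "((\<lambda>x. std_normal_density (inv std_normal_cdf x)) has_real_derivative
     - inv std_normal_cdf x) (at x)"
    using gaussian_profile_pos[OF assms] by simp
  then show ?thesis
    by (rule has_field_derivative_transform_within_open[where S = "{0<..<1}"])
       (use assms in \<open>auto simp: gaussian_profile_def\<close>)
qed

lemma gaussian_profile_concave: "concave_on {0<..<1} gaussian_profile"
proof (rule f''_le0_imp_concave)
  fix x :: real assume x: "x \<in> {0<..<1}"
  show "(gaussian_profile has_real_derivative - inv std_normal_cdf x) (at x)"
    using gaussian_profile_deriv x by auto
  show "((\<lambda>x. - inv std_normal_cdf x) has_real_derivative - (1 / gaussian_profile x)) (at x)"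
    using inv_std_normal_cdf_deriv x by (auto intro!: derivative_intros)
  show "- (1 / gaussian_profile x) \<le> 0"
    using gaussian_profile_nonneg by simp
qed simp

text \<open>
  This is the whole discrete content of the argument: it bounds, along a single edge, the
  difference of \<open>L (\<I> g)\<close> and \<open>\<I>' (g) L g\<close>, which on a diffusion would be \<open>\<I>'' (g) \<Gamma> g = - \<Gamma> g / \<I> (g)\<close>.
  The second order Taylor
  remainder of \<open>\<I>\<close> at \<open>a\<close> is \<open>\<integral> (c - s) \<I>'' (s) ds = - \<integral> (c - s) / \<I> (s) ds\<close> over the segment from \<open>a\<close>
  to \<open>c\<close>. Concavity and \<open>\<I> c \<ge> 0\<close> give \<open>\<I> (s) \<ge> \<I> (a) (c - s) / (c - a)\<close> there, so the integrand
  is at most \<open>(c - a) / \<I> (a)\<close> in absolute value. A mean value point of \<open>k\<close> below replaces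
  the integral.
\<close>

lemma gaussian_profile_two_point:
  assumes a: "0 < a" "a < 1" and c: "0 < c" "c < 1"
  shows "0 \<le> gaussian_profile a *
    (gaussian_profile c - gaussian_profile a + inv std_normal_cdf a * (c - a)) + (c - a)\<^sup>2"
proof (cases "a = c")
  case False
  \<comment> \<open>The first order Taylor approximation of the profile at \<open>c\<close>, as a function of its base point
    \<open>s\<close>. It equals \<open>\<I> c\<close> at \<open>s = c\<close>, and its derivative is \<open>\<I>'' (s) (c - s)\<close>. The segment is
    parametrised by \<open>\<theta>\<close> so that \<open>a < c\<close> and \<open>c < a\<close> are one case.\<close>
  define k where "k s = gaussian_profile s - inv std_normal_cdf s * (c - s)" for s
  have in01: "0 < a + \<theta> * (c - a) \<and> a + \<theta> * (c - a) < 1" if "0 \<le> \<theta>" "\<theta> \<le> 1" for \<theta>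
  proof -
    have "a + \<theta> * (c - a) = (1 - \<theta>) * a + \<theta> * c" by algebra
    moreover have "min a c \<le> (1 - \<theta>) * a + \<theta> * c \<and> (1 - \<theta>) * a + \<theta> * c \<le> max a c"
      using that convex_bound_le[of a "max a c" c "1 - \<theta>" \<theta>]
        convex_bound_le[of "- a" "- min a c" "- c" "1 - \<theta>" \<theta>] by auto
    ultimately show ?thesis using a c by (auto simp: min_def max_def split: if_splits)
  qed
  have k': "(k has_real_derivative - ((c - s) / gaussian_profile s)) (at s)" if "0 < s" "s < 1" for s
    unfolding k_def using that
    by (auto intro!: derivative_eq_intros gaussian_profile_deriv inv_std_normal_cdf_deriv)
  have k: "((\<lambda>\<theta>. k (a + \<theta> * (c - a))) has_real_derivative
      - ((c - a)\<^sup>2 * (1 - \<theta>) / gaussian_profile (a + \<theta> * (c - a)))) (at \<theta>)"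
    if "0 \<le> \<theta>" "\<theta> \<le> 1" for \<theta>
  proof -
    have "((\<lambda>\<theta>. a + \<theta> * (c - a)) has_real_derivative c - a) (at \<theta>)"
      by (auto intro!: derivative_eq_intros)
    from DERIV_chain2[OF k' this] in01[OF that]
    have "((\<lambda>\<theta>. k (a + \<theta> * (c - a))) has_real_derivative
        - ((c - (a + \<theta> * (c - a))) / gaussian_profile (a + \<theta> * (c - a))) * (c - a)) (at \<theta>)"
      by blast
    moreover have "c - (a + \<theta> * (c - a)) = (1 - \<theta>) * (c - a)" by algebra
    ultimately show ?thesis by (simp add: power2_eq_square mult_ac)
  qed
  obtain \<theta> where \<theta>: "0 < \<theta>" "\<theta> < 1"
    and eq: "k c - k a = - ((c - a)\<^sup>2 * (1 - \<theta>) / gaussian_profile (a + \<theta> * (c - a)))"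
    using MVT2[OF _ k, of 0 1] by auto
  let ?m = "a + \<theta> * (c - a)"
  have pos: "0 < gaussian_profile ?m"
    using in01[of \<theta>] \<theta> gaussian_profile_pos by auto
  have "(1 - \<theta>) * gaussian_profile a \<le> (1 - \<theta>) * gaussian_profile a + \<theta> * gaussian_profile c"
    using \<theta> gaussian_profile_nonneg by simp
  also have "\<dots> \<le> gaussian_profile ((1 - \<theta>) *\<^sub>R a + \<theta> *\<^sub>R c)"
    using \<theta> a c by (intro concave_onD[OF gaussian_profile_concave]) auto
  also have "(1 - \<theta>) *\<^sub>R a + \<theta> *\<^sub>R c = ?m" by (simp add: algebra_simps)
  finally have "(1 - \<theta>) * gaussian_profile a / gaussian_profile ?m \<le> 1"
    using pos by simp
  then have "(c - a)\<^sup>2 * ((1 - \<theta>) * gaussian_profile a / gaussian_profile ?m) \<le> (c - a)\<^sup>2"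
    by (intro mult_left_le) auto
  moreover have "gaussian_profile c - gaussian_profile a + inv std_normal_cdf a * (c - a) = k c - k a"
    by (simp add: k_def)
  moreover have "gaussian_profile a * (k c - k a)
      = - ((c - a)\<^sup>2 * ((1 - \<theta>) * gaussian_profile a / gaussian_profile ?m))"
    unfolding eq by simp
  ultimately show ?thesis by simp
qed simp


text \<open>
  A crude tail bound, sufficient to make the profile continuous at the end points of \<open>[0, 1]\<close>.
\<close>

lemma std_normal_density_le_inverse:
  assumes "z \<noteq> 0"
  shows "std_normal_density z \<le> 1 / \<bar>z\<bar>"
proof -
  \<comment> \<open>The right-hand side minus the left-hand side is \<open>((\<bar>z\<bar> - 1)\<^sup>2 + 1) / 2\<close>.\<close>
  have "\<bar>z\<bar> \<le> 1 + z\<^sup>2 / 2"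
    using zero_le_power2[of "\<bar>z\<bar> - 1"] by (simp add: power2_diff)
  also have "\<dots> \<le> exp (z\<^sup>2 / 2)" by (rule exp_ge_add_one_self)
  finally have "exp (- (z\<^sup>2 / 2)) \<le> 1 / \<bar>z\<bar>"
    using assms by (simp add: exp_minus field_simps)
  moreover have "1 / sqrt (2 * pi) \<le> 1"
    using pi_gt3 by simp
  ultimately have "1 / sqrt (2 * pi) * exp (- (z\<^sup>2 / 2)) \<le> 1 * (1 / \<bar>z\<bar>)"
    by (intro mult_mono) auto
  then show ?thesis by (simp add: std_normal_density_def)
qed

lemma gaussian_profile_small_near_endpoints:
  assumes "0 < e"
  obtains \<delta> where "0 < \<delta>" "\<delta> < 1" "\<And>x. x < \<delta> \<Longrightarrow> gaussian_profile x < e"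
    "\<And>x. 1 - \<delta> < x \<Longrightarrow> gaussian_profile x < e"
proof -
  define B where "B = 2 / e"
  have B: "std_normal_density z < e" if "\<bar>B\<bar> < \<bar>z\<bar>" for z
  proof -
    have "z \<noteq> 0" using that by auto
    have "std_normal_density z \<le> 1 / \<bar>z\<bar>"
      using std_normal_density_le_inverse[OF \<open>z \<noteq> 0\<close>] .
    also have "\<dots> < e"
      using that assms \<open>z \<noteq> 0\<close> by (simp add: B_def field_simps)
    finally show ?thesis .
  qed
  define \<delta> where "\<delta> = min (std_normal_cdf (- \<bar>B\<bar>)) (1 - std_normal_cdf \<bar>B\<bar>)"
  have "gaussian_profile x < e" if "x < \<delta> \<or> 1 - \<delta> < x" for x
  proof (cases "0 < x \<and> x < 1")
    case True
    then obtain z where z: "std_normal_cdf z = x" using std_normal_cdf_onto by blast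
    have "z < - \<bar>B\<bar> \<or> \<bar>B\<bar> < z"
      using that strict_mono_less[OF std_normal_cdf_strict_mono, of z "- \<bar>B\<bar>"]
        strict_mono_less[OF std_normal_cdf_strict_mono, of "\<bar>B\<bar>" z] unfolding z \<delta>_def by linarith
    then have "std_normal_density z < e" by (intro B) linarith
    then show ?thesis using True z by (auto simp: gaussian_profile_def)
  qed (use assms in \<open>auto simp: gaussian_profile_def\<close>)
  moreover have "0 < \<delta>" "\<delta> < 1"
    using std_normal_cdf_strictly_between[of "- \<bar>B\<bar>"] std_normal_cdf_strictly_between[of "\<bar>B\<bar>"]
    by (auto simp: \<delta>_def)
  ultimately show ?thesis using that by blast
qed

text \<open>
  Continuity at \<open>0\<close> and \<open>1\<close>, where the profile has infinite slope, is what lets the final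
  theorem be deduced from functions with values inside \<open>(0, 1)\<close>.
\<close>

lemma isCont_gaussian_profile: "isCont gaussian_profile x"
proof (cases "0 < x \<and> x < 1")
  case True
  then show ?thesis using DERIV_isCont gaussian_profile_deriv by blast
next
  case False
  have "(gaussian_profile \<longlongrightarrow> 0) (at x)"
  proof (rule order_tendstoI)
    fix e :: real assume "0 < e"
    then obtain \<delta> where \<delta>: "0 < \<delta>" "\<delta> < 1" "\<And>x. x < \<delta> \<Longrightarrow> gaussian_profile x < e"
      "\<And>x. 1 - \<delta> < x \<Longrightarrow> gaussian_profile x < e"
      using gaussian_profile_small_near_endpoints by metis
    have "open ({..<\<delta>} \<union> {1 - \<delta><..})" "x \<in> {..<\<delta>} \<union> {1 - \<delta><..}"
      using False \<delta> by auto
    then have "\<forall>\<^sub>F y in at x. y \<in> {..<\<delta>} \<union> {1 - \<delta><..}"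
      by (rule eventually_at_in_open')
    then show "\<forall>\<^sub>F y in at x. gaussian_profile y < e"
      by (rule eventually_mono) (use \<delta> in auto)
  next
    fix e :: real assume "e < 0"
    then show "\<forall>\<^sub>F y in at x. e < gaussian_profile y"
      by (intro always_eventually allI less_le_trans[OF _ gaussian_profile_nonneg])
  qed
  moreover have "gaussian_profile x = 0" using False by (auto simp: gaussian_profile_def)
  ultimately show ?thesis by (simp add: isCont_def)
qed

section \<open>The semigroup on the cube\<close>

lemma finite_cube: "finite (cube :: (int ^ 'n::finite) set)"
proof -
  have "(cube :: (int ^ 'n) set) \<subseteq> vec_lambda ` (PiE UNIV (\<lambda>_. {- 1, 1}))"
  proof
    fix x :: "int ^ 'n" assume "x \<in> cube"
    then show "x \<in> vec_lambda ` (PiE UNIV (\<lambda>_. {- 1, 1}))"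
      by (intro image_eqI[of _ _ "vec_nth x"]) (auto simp: cube_def)
  qed
  then show ?thesis
    by (rule finite_subset) (intro finite_imageI finite_PiE; simp)
qed

text \<open>
  The cube is closed under flips, so the values of a function outside it never enter.
\<close>

lemma generator_pow_cong_cube:
  assumes "\<And>y. y \<in> cube \<Longrightarrow> f y = g y" "x \<in> cube"
  shows "(generator q ^^ k) f x = (generator q ^^ k) g x"
  using assms(2)
  by (induction k arbitrary: x) (auto simp: assms(1) generator_def flip_in_cube)

lemma generator_sum:
  "generator q (\<lambda>x. \<Sum>y\<in>A. c y * h y x) = (\<lambda>x. \<Sum>y\<in>A. c y * generator q (h y) x)"
proof
  fix x
  have "generator q (\<lambda>x. \<Sum>y\<in>A. c y * h y x) x
      = (\<Sum>i\<in>UNIV. \<Sum>y\<in>A. c y * (q i x * (h y (flip i x) - h y x)))"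
    unfolding generator_def by (simp add: sum_distrib_left right_diff_distrib sum_subtractf algebra_simps)
  then show "generator q (\<lambda>x. \<Sum>y\<in>A. c y * h y x) x = (\<Sum>y\<in>A. c y * generator q (h y) x)"
    by (simp add: generator_def sum_distrib_left sum.swap[of _ A])
qed

lemma generator_pow_sum:
  "(generator q ^^ k) (\<lambda>x. \<Sum>y\<in>A. c y * h y x) = (\<lambda>x. \<Sum>y\<in>A. c y * (generator q ^^ k) (h y) x)"
  by (induction k) (simp_all add: generator_sum)

text \<open>
  On the cube \<open>L\<close> is bounded for the supremum norm, which makes the exponential series
  converge absolutely.
\<close>

lemma generator_pow_bound:
  fixes q :: "'n::finite \<Rightarrow> int ^ 'n \<Rightarrow> real"
  obtains R M where "0 \<le> R" "\<And>k x. x \<in> cube \<Longrightarrow> \<bar>(generator q ^^ k) f x\<bar> \<le> R ^ k * M"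
proof -
  define R where "R = 2 * (\<Sum>x\<in>cube. \<Sum>i\<in>UNIV. \<bar>q i x\<bar>)"
  define M where "M = (\<Sum>x\<in>cube. \<bar>f x\<bar>)"
  have step: "\<bar>generator q g x\<bar> \<le> R * B"
    if x: "x \<in> cube" and B: "\<And>y. y \<in> cube \<Longrightarrow> \<bar>g y\<bar> \<le> B" for g B x
  proof -
    have "0 \<le> B" using B[OF x] by linarith
    have "\<bar>generator q g x\<bar> \<le> (\<Sum>i\<in>UNIV. \<bar>q i x\<bar> * \<bar>g (flip i x) - g x\<bar>)"
      unfolding generator_def abs_mult[symmetric] by (rule sum_abs)
    also have "\<dots> \<le> (\<Sum>i\<in>UNIV. \<bar>q i x\<bar> * (2 * B))"
    proof (intro sum_mono mult_left_mono)
      fix i show "\<bar>g (flip i x) - g x\<bar> \<le> 2 * B"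
        using B[OF x] B[OF flip_in_cube[OF x], of i] by linarith
    qed auto
    also have "\<dots> = 2 * (\<Sum>i\<in>UNIV. \<bar>q i x\<bar>) * B" by (simp add: sum_distrib_left sum_distrib_right mult_ac)
    also have "\<dots> \<le> R * B"
      unfolding R_def using x \<open>0 \<le> B\<close>
      by (intro mult_right_mono mult_left_mono member_le_sum[of x cube]) (auto simp: finite_cube intro: sum_nonneg)
    finally show ?thesis .
  qed
  have "\<bar>(generator q ^^ k) f x\<bar> \<le> R ^ k * M" if "x \<in> cube" for k x
    using that
  proof (induction k arbitrary: x)
    case 0 then show ?case
      unfolding M_def by (auto intro: member_le_sum[of x cube] simp: finite_cube)
  next
    case (Suc k)
    then show ?case using step[of x "(generator q ^^ k) f" "R ^ k * M"] by (simp add: mult.assoc)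
  qed
  moreover have "0 \<le> R" by (simp add: R_def sum_nonneg)
  ultimately show ?thesis using that by blast
qed

lemma summable_markov_semigroup:
  assumes "x \<in> cube"
  shows "summable (\<lambda>k. \<bar>t ^ k / fact k * (generator q ^^ k) f x\<bar>)"
proof -
  obtain R M where R: "0 \<le> R" "\<And>k x. x \<in> cube \<Longrightarrow> \<bar>(generator q ^^ k) f x\<bar> \<le> R ^ k * M"
    using generator_pow_bound by blast
  have "summable (\<lambda>k. inverse (fact k) * (\<bar>t\<bar> * R) ^ k * M)"
    by (intro summable_mult2 summable_exp)
  then show ?thesis
  proof (rule summable_comparison_test')
    fix k :: nat assume "0 \<le> k"
    show "norm \<bar>t ^ k / fact k * (generator q ^^ k) f x\<bar> \<le> inverse (fact k) * (\<bar>t\<bar> * R) ^ k * M"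
      using mult_left_mono[OF R(2)[OF assms, of k], of "\<bar>t\<bar> ^ k / fact k"]
      by (simp add: abs_mult power_abs power_mult_distrib field_simps)
  qed
qed

lemma markov_semigroup_0 [simp]: "markov_semigroup q 0 f x = f x"
proof -
  have "(\<lambda>k. 0 ^ k / fact k * (generator q ^^ k) f x) = (\<lambda>k. if k = 0 then f x else 0)"
    by auto
  then show ?thesis
    using sums_single[of 0 "\<lambda>_. f x"] by (simp add: markov_semigroup_def sums_iff)
qed

text \<open>
  The exponential series is a power series in \<open>t\<close>, and differentiating it term by term shifts the powers of
  the generator by one. The generator can be pulled out in front of \<open>P\<^sub>t\<close> or kept inside; both forms of the
  derivative are needed, the first for \<open>P\<^sub>t\<^sub>-\<^sub>s f\<close> and the second for the outer semigroup in the
  interpolation.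
\<close>

lemma markov_semigroup_has_derivative_inner:
  assumes "x \<in> cube"
  shows "((\<lambda>t. markov_semigroup q t f x) has_real_derivative markov_semigroup q t (generator q f) x) (at t)"
proof -
  let ?c = "\<lambda>k. (generator q ^^ k) f x / fact k"
  have "summable (\<lambda>k. ?c k * y ^ k)" for y
    using summable_rabs_cancel[OF summable_markov_semigroup[OF assms, of y q f]]
    by (simp add: mult_ac)
  from termdiffs_strong_converges_everywhere[OF this]
  have "((\<lambda>t. \<Sum>k. ?c k * t ^ k) has_real_derivative (\<Sum>k. diffs ?c k * t ^ k)) (at t)" .
  moreover have "diffs ?c k = (generator q ^^ k) (generator q f) x / fact k" for k
  proof -
    have "diffs ?c k = real (Suc k) * ((generator q ^^ k) (generator q f) x / fact (Suc k))"
      by (simp add: diffs_def funpow_swap1)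
    also have "\<dots> = (generator q ^^ k) (generator q f) x / fact k"
      by (simp del: of_nat_Suc)
    finally show ?thesis .
  qed
  ultimately show ?thesis
    by (simp add: markov_semigroup_def mult_ac)
qed

lemma markov_semigroup_commute:
  assumes "x \<in> cube"
  shows "markov_semigroup q t (generator q f) x = generator q (markov_semigroup q t f) x"
proof -
  note sums = summable_sums[OF summable_rabs_cancel[OF summable_markov_semigroup]]
  have "(\<lambda>k. \<Sum>i\<in>UNIV. q i x * (t ^ k / fact k * (generator q ^^ k) f (flip i x)
        - t ^ k / fact k * (generator q ^^ k) f x))
     sums (\<Sum>i\<in>UNIV. q i x * (markov_semigroup q t f (flip i x) - markov_semigroup q t f x))"
    unfolding markov_semigroup_def
    by (intro sums_sum sums_mult sums_diff sums flip_in_cube assms)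
  moreover have "(\<Sum>i\<in>UNIV. q i x * (t ^ k / fact k * (generator q ^^ k) f (flip i x)
        - t ^ k / fact k * (generator q ^^ k) f x)) = t ^ k / fact k * (generator q ^^ k) (generator q f) x" for k
  proof -
    have "(generator q ^^ k) (generator q f) = generator q ((generator q ^^ k) f)"
      by (simp add: funpow_swap1)
    then show ?thesis
      by (simp add: generator_def sum_distrib_left algebra_simps)
  qed
  ultimately show ?thesis
    unfolding markov_semigroup_def[of _ _ "generator q f"] generator_def[of _ "markov_semigroup q t f"]
    by (simp add: sums_iff)
qed

lemma markov_semigroup_has_derivative:
  assumes "x \<in> cube"
  shows "((\<lambda>t. markov_semigroup q t f x) has_real_derivative generator q (markov_semigroup q t f) x) (at t)"
  using markov_semigroup_has_derivative_inner[OF assms] markov_semigroup_commute[OF assms] by metis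

text \<open>
  The transition kernel \<open>P\<^sub>t(x, y)\<close> is \<open>P\<^sub>t\<close> applied to the indicator of \<open>y\<close>. Writing \<open>P\<^sub>t\<close>
  as a finite sum over it reduces linearity, the product rule and the passage to the limit to facts about finite sums.
\<close>

lemma markov_semigroup_kernel:
  assumes "x \<in> cube"
  shows "markov_semigroup q t f x = (\<Sum>y\<in>cube. f y * markov_semigroup q t (indicator {y}) x)"
proof -
  have "(generator q ^^ k) f x = (\<Sum>y\<in>cube. f y * (generator q ^^ k) (indicator {y}) x)" for k
  proof -
    have "(generator q ^^ k) f x = (generator q ^^ k) (\<lambda>x. \<Sum>y\<in>cube. f y * indicator {y} x) x"
    proof (rule generator_pow_cong_cube[OF _ assms])
      fix z :: "int ^ 'a" assume "z \<in> cube"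
      then show "f z = (\<Sum>y\<in>cube. f y * indicator {y} z)"
        by (simp add: indicator_def finite_cube if_distrib cong: if_cong)
    qed
    then show ?thesis by (simp add: generator_pow_sum)
  qed
  then have "markov_semigroup q t f x
      = (\<Sum>k. \<Sum>y\<in>cube. f y * (t ^ k / fact k * (generator q ^^ k) (indicator {y}) x))"
    unfolding markov_semigroup_def by (simp add: sum_distrib_left mult_ac)
  also have "\<dots> = (\<Sum>y\<in>cube. \<Sum>k. f y * (t ^ k / fact k * (generator q ^^ k) (indicator {y}) x))"
    by (intro suminf_sum summable_mult summable_rabs_cancel[OF summable_markov_semigroup] assms)
  also have "\<dots> = (\<Sum>y\<in>cube. f y * markov_semigroup q t (indicator {y}) x)"
    unfolding markov_semigroup_def
    by (intro sum.cong refl suminf_mult summable_rabs_cancel[OF summable_markov_semigroup] assms)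
  finally show ?thesis .
qed

lemma markov_semigroup_const:
  fixes q :: "'n::finite \<Rightarrow> int ^ 'n \<Rightarrow> real"
  shows "markov_semigroup q t (\<lambda>_. c) x = c"
proof -
  have "(generator q ^^ Suc k) (\<lambda>_. c) = (\<lambda>_. 0)" for k
    by (induction k) (auto simp: generator_def fun_eq_iff)
  then have "(\<lambda>k. t ^ k / fact k * (generator q ^^ k) (\<lambda>_. c) x) = (\<lambda>k. if k = 0 then c else 0)"
    by (auto simp: fun_eq_iff gr0_conv_Suc simp del: funpow.simps(2))
  then show ?thesis
    using sums_single[of 0 "\<lambda>_. c"] by (simp add: markov_semigroup_def sums_iff)
qed

lemma markov_semigroup_affine:
  assumes "x \<in> cube"
  shows "markov_semigroup q t (\<lambda>y. a * f y + c) x = a * markov_semigroup q t f x + c"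
proof -
  have "markov_semigroup q t (\<lambda>y. a * f y + c) x
     = a * markov_semigroup q t f x + markov_semigroup q t (\<lambda>_. c) x"
    unfolding markov_semigroup_kernel[OF assms, of q t "\<lambda>y. a * f y + c"]
      markov_semigroup_kernel[OF assms, of q t f] markov_semigroup_kernel[OF assms, of q t "\<lambda>_. c"]
    by (simp add: algebra_simps sum.distrib sum_distrib_left)
  then show ?thesis by (simp add: markov_semigroup_const)
qed

text \<open>
  Off the diagonal \<open>L\<close> has nonnegative entries, so \<open>L + c\<close> is a nonnegative matrix for large \<open>c\<close>, and
  \<open>exp (t L) = exp (- c t) exp (t (L + c))\<close> is nonnegative. Here \<open>T k\<close> is the \<open>k\<close>-th term of the series of
  \<open>exp (t (L + c)) f\<close>, obtained as the Cauchy product of the series of \<open>exp (t L) f\<close> and \<open>exp (c t)\<close>.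
\<close>

lemma markov_semigroup_nonneg:
  fixes q :: "'n::finite \<Rightarrow> int ^ 'n \<Rightarrow> real"
  assumes q: "\<forall>i. \<forall>x\<in>cube. 0 \<le> q i x" and t: "0 \<le> t"
    and f: "\<And>y. y \<in> cube \<Longrightarrow> 0 \<le> f y" and x: "x \<in> cube"
  shows "0 \<le> markov_semigroup q t f x"
proof -
  define c where "c = (\<Sum>y\<in>cube. \<Sum>i\<in>UNIV. q i y)"
  define a where "a x k = t ^ k / fact k * (generator q ^^ k) f x" for x k
  define e where "e k = (c * t) ^ k / fact k" for k
  define T where "T k x = (\<Sum>i\<le>k. a x i * e (k - i))" for k x
  have c: "(\<Sum>i\<in>UNIV. q i y) \<le> c" if "y \<in> cube" for y
    unfolding c_def using that q
    by (intro member_le_sum[of y cube]) (auto simp: finite_cube intro: sum_nonneg)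
  have Suc_a: "real (Suc i) * a x (Suc i) = t * (\<Sum>j\<in>UNIV. q j x * (a (flip j x) i - a x i))" for i x
  proof -
    have "real (Suc i) * (t ^ Suc i / fact (Suc i)) = t * (t ^ i / fact i)"
      by (simp del: of_nat_Suc)
    then have "real (Suc i) * a x (Suc i) = t * (t ^ i / fact i) * generator q ((generator q ^^ i) f) x"
      unfolding a_def by (simp flip: mult.assoc)
    then show ?thesis
      by (simp add: a_def generator_def sum_distrib_left right_diff_distrib mult_ac)
  qed
  have Suc_e: "real (Suc i) * e (Suc i) = c * t * e i" for i
    by (simp add: e_def del: of_nat_Suc)
  \<comment> \<open>This recursion \<open>(k + 1) T\<^sub>k\<^sub>+\<^sub>1 = t (L + c) T\<^sub>k\<close> identifies the Cauchy product with the
    series of \<open>exp (t (L + c))\<close>; it comes from splitting the factor \<open>k + 1\<close> as \<open>i + (k + 1 - i)\<close>.\<close>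
  have Suc_T: "real (Suc k) * T (Suc k) x = t * ((\<Sum>j\<in>UNIV. q j x * (T k (flip j x) - T k x)) + c * T k x)" for k x
  proof -
    have "real (Suc k) * T (Suc k) x = (\<Sum>i\<le>Suc k. (real i + real (Suc k - i)) * (a x i * e (Suc k - i)))"
      unfolding T_def sum_distrib_left by (intro sum.cong) (auto simp: of_nat_diff)
    also have "\<dots> = (\<Sum>i\<le>Suc k. (real i * a x i) * e (Suc k - i))
        + (\<Sum>i\<le>Suc k. a x i * (real (Suc k - i) * e (Suc k - i)))"
      by (simp only: algebra_simps flip: sum.distrib)
    also have "(\<Sum>i\<le>Suc k. (real i * a x i) * e (Suc k - i))
       = (\<Sum>i\<le>k. (real (Suc i) * a x (Suc i)) * e (k - i))"
      by (subst sum.atMost_Suc_shift) simp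
    also have "\<dots> = t * (\<Sum>j\<in>UNIV. q j x * (T k (flip j x) - T k x))"
      unfolding Suc_a T_def sum_subtractf[symmetric] sum_distrib_left sum_distrib_right
      by (subst sum.swap) (simp add: algebra_simps)
    also have "(\<Sum>i\<le>Suc k. a x i * (real (Suc k - i) * e (Suc k - i)))
       = (\<Sum>i\<le>k. a x i * (real (Suc (k - i)) * e (Suc (k - i))))"
      by (simp add: Suc_diff_le del: of_nat_Suc of_nat_diff)
    also have "\<dots> = t * c * T k x"
      unfolding Suc_e T_def by (simp add: sum_distrib_left mult_ac)
    finally show ?thesis by (simp add: algebra_simps)
  qed
  have T: "0 \<le> T k y" if "y \<in> cube" for k y
    using that
  proof (induction k arbitrary: y)
    case 0 then show ?case by (simp add: T_def a_def e_def f)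
  next
    case (Suc k)
    have "(\<Sum>j\<in>UNIV. q j y * (T k (flip j y) - T k y)) + c * T k y
       = (\<Sum>j\<in>UNIV. q j y * T k (flip j y)) + (c - (\<Sum>i\<in>UNIV. q i y)) * T k y"
      by (simp add: right_diff_distrib left_diff_distrib sum_subtractf sum_distrib_right)
    also have "0 \<le> \<dots>"
      using Suc c q by (intro add_nonneg_nonneg sum_nonneg mult_nonneg_nonneg) (auto simp: flip_in_cube)
    finally have "0 \<le> real (Suc k) * T (Suc k) y" unfolding Suc_T using t by simp
    then show ?case by (simp add: zero_le_mult_iff)
  qed
  have "summable (\<lambda>k. norm (e k))"
    using summable_norm_exp[of "c * t"] by (simp add: e_def field_simps)
  moreover have "summable (\<lambda>k. norm (a x k))"
    using summable_markov_semigroup[OF x] by (simp add: a_def)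
  ultimately have "(\<lambda>k. T k x) sums ((\<Sum>k. a x k) * (\<Sum>k. e k))"
    unfolding T_def by (intro Cauchy_product_sums)
  then have "0 \<le> (\<Sum>k. a x k) * (\<Sum>k. e k)"
    using T[OF x] suminf_nonneg[of "\<lambda>k. T k x"] by (simp add: sums_iff)
  moreover have "(\<Sum>k. e k) = exp (c * t)"
    by (simp add: e_def exp_def field_simps)
  moreover have "(\<Sum>k. a x k) = markov_semigroup q t f x"
    by (simp add: a_def markov_semigroup_def)
  ultimately show ?thesis by (simp add: zero_le_mult_iff)
qed

text \<open>
  The product rule, applied to each of the finitely many terms of the kernel sum, so that no uniformity in the
  state is required. The derivative of the kernel is turned back into \<open>L\<close> acting on \<open>F s\<close> by
  comparison with the case of a function that does not move.
\<close>

lemma markov_semigroup_has_derivative_moving: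
  fixes q :: "'n::finite \<Rightarrow> int ^ 'n \<Rightarrow> real"
  assumes "x \<in> cube"
    and F: "\<And>y. y \<in> cube \<Longrightarrow> ((\<lambda>s. F s y) has_real_derivative D y) (at s)"
  shows "((\<lambda>s. markov_semigroup q s (F s) x) has_real_derivative
      markov_semigroup q s (\<lambda>y. generator q (F s) y + D y) x) (at s)"
proof -
  let ?p = "\<lambda>s y. markov_semigroup q s (indicator {y}) x"
  let ?p' = "\<lambda>y. markov_semigroup q s (generator q (indicator {y})) x"
  have "((\<lambda>s. \<Sum>y\<in>cube. F s y * ?p s y) has_real_derivative
      (\<Sum>y\<in>cube. F s y * ?p' y) + (\<Sum>y\<in>cube. D y * ?p s y)) (at s)"
    by (auto intro!: derivative_eq_intros F markov_semigroup_has_derivative_inner[OF assms(1)]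
       simp: sum.distrib mult_ac)
  moreover have "(\<lambda>s. \<Sum>y\<in>cube. F s y * ?p s y) = (\<lambda>s. markov_semigroup q s (F s) x)"
    by (rule ext, rule markov_semigroup_kernel[OF assms(1), symmetric])
  moreover have "(\<Sum>y\<in>cube. F s y * ?p' y) = markov_semigroup q s (generator q (F s)) x"
  proof (rule DERIV_unique)
    show "((\<lambda>u. markov_semigroup q u (F s) x) has_real_derivative
       markov_semigroup q s (generator q (F s)) x) (at s)"
      by (rule markov_semigroup_has_derivative_inner[OF assms(1)])
    show "((\<lambda>u. markov_semigroup q u (F s) x) has_real_derivative (\<Sum>y\<in>cube. F s y * ?p' y)) (at s)"
      unfolding markov_semigroup_kernel[OF assms(1), of q _ "F s"]
      by (auto intro!: derivative_eq_intros markov_semigroup_has_derivative_inner[OF assms(1)] simp: mult_ac)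
  qed
  moreover have "markov_semigroup q s (\<lambda>y. generator q (F s) y + D y) x
     = markov_semigroup q s (generator q (F s)) x + (\<Sum>y\<in>cube. D y * ?p s y)"
    unfolding markov_semigroup_kernel[OF assms(1), of q s "\<lambda>y. generator q (F s) y + D y"]
     markov_semigroup_kernel[OF assms(1), of q s "generator q (F s)"]
    by (simp add: distrib_right sum.distrib)
  ultimately show ?thesis by simp
qed

section \<open>Calculus of the carre du champ operators\<close>

lemma Gamma_w_eq_sum_squares:
  "Gamma_w q w f x = (\<Sum>i\<in>UNIV. w i x * (q i x * (f (flip i x) - f x)\<^sup>2)) / 2"
  by (simp add: Gamma_w_def carre_du_champ_def power2_eq_square mult_ac)

lemma Gamma_unweighted_eq_sum_squares:
  "Gamma_unweighted q f x = (\<Sum>i\<in>UNIV. q i x * (f (flip i x) - f x)\<^sup>2) / 2"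
  by (simp add: Gamma_unweighted_def Gamma_w_eq_sum_squares)

text \<open>
  The sum over edges of \<open>v\<^sup>2 - u\<^sup>2 = 2 u (v - u) + (v - u)\<^sup>2\<close>. For the square function the diffusion chain
  rule is thus exact on the cube.
\<close>

lemma generator_square:
  "generator q (\<lambda>y. (F y)\<^sup>2) x = 2 * F x * generator q F x + 2 * Gamma_unweighted q F x"
proof -
  have "2 * Gamma_unweighted q F x = (\<Sum>i\<in>UNIV. q i x * (F (flip i x) - F x)\<^sup>2)"
    by (simp add: Gamma_unweighted_eq_sum_squares)
  then show ?thesis
    unfolding generator_def
    by (simp add: sum_distrib_left flip: sum.distrib) (simp add: power2_eq_square algebra_simps)
qed

lemma Gamma_w_nonneg:
  assumes "\<forall>i. \<forall>x\<in>cube. 0 \<le> q i x" and "0 < b" and "bounded_weights b w" and "x \<in> cube"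
  shows "0 \<le> Gamma_w q w f x"
proof -
  have "0 \<le> w i x" for i
    using assms(2-4) unfolding bounded_weights_def by (meson less_imp_le order_trans)
  then show ?thesis
    using assms(1,4) unfolding Gamma_w_eq_sum_squares by (simp add: sum_nonneg)
qed

lemma Gamma_unweighted_le_Gamma_w:
  assumes "\<forall>i. \<forall>x\<in>cube. 0 \<le> q i x" and "bounded_weights b w" and "x \<in> cube"
  shows "b * Gamma_unweighted q f x \<le> Gamma_w q w f x"
proof -
  have "(\<Sum>i\<in>UNIV. b * (q i x * (f (flip i x) - f x)\<^sup>2))
      \<le> (\<Sum>i\<in>UNIV. w i x * (q i x * (f (flip i x) - f x)\<^sup>2))"
    using assms by (intro sum_mono mult_right_mono) (auto simp: bounded_weights_def)
  then show ?thesis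
    by (simp add: Gamma_unweighted_eq_sum_squares Gamma_w_eq_sum_squares sum_distrib_left)
qed

text \<open>
  The root is the Euclidean length of the planar vector \<open>(u, sqrt (c G))\<close>, and along each edge the length of
  a vector changes by at most the length of the change.
\<close>

lemma Gamma_sqrt_sum_le:
  assumes "\<forall>i. \<forall>x\<in>cube. 0 \<le> q i x" and "0 \<le> c" and x: "x \<in> cube"
    and G: "\<And>y. y \<in> cube \<Longrightarrow> 0 \<le> G y"
  shows "Gamma_unweighted q (\<lambda>y. sqrt ((u y)\<^sup>2 + c * G y)) x
    \<le> Gamma_unweighted q u x + c * Gamma_unweighted q (\<lambda>y. sqrt (G y)) x"
proof -
  let ?F = "\<lambda>y. sqrt ((u y)\<^sup>2 + c * G y)"
  have edge: "(?F y - ?F x)\<^sup>2 \<le> (u y - u x)\<^sup>2 + c * (sqrt (G y) - sqrt (G x))\<^sup>2"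
    if y: "y \<in> cube" for y
  proof -
    have F: "?F z = cmod (Complex (u z) (sqrt c * sqrt (G z)))" if "z \<in> cube" for z
      using G[OF that] \<open>0 \<le> c\<close> by (simp add: cmod_def power_mult_distrib)
    have "\<bar>?F y - ?F x\<bar> \<le> cmod (Complex (u y) (sqrt c * sqrt (G y)) - Complex (u x) (sqrt c * sqrt (G x)))"
      unfolding F[OF y] F[OF x] by (rule norm_triangle_ineq3)
    then have "\<bar>?F y - ?F x\<bar>\<^sup>2 \<le> (cmod (Complex (u y - u x) (sqrt c * (sqrt (G y) - sqrt (G x)))))\<^sup>2"
      by (intro power_mono) (simp_all add: right_diff_distrib minus_complex.code)
    then show ?thesis
      using \<open>0 \<le> c\<close> by (simp add: cmod_power2 power_mult_distrib)
  qed
  have "(\<Sum>i\<in>UNIV. q i x * (?F (flip i x) - ?F x)\<^sup>2)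
      \<le> (\<Sum>i\<in>UNIV. q i x * ((u (flip i x) - u x)\<^sup>2 + c * (sqrt (G (flip i x)) - sqrt (G x))\<^sup>2))"
    using assms(1) x by (intro sum_mono mult_left_mono edge flip_in_cube) auto
  also have "\<dots> = (\<Sum>i\<in>UNIV. q i x * (u (flip i x) - u x)\<^sup>2)
      + c * (\<Sum>i\<in>UNIV. q i x * (sqrt (G (flip i x)) - sqrt (G x))\<^sup>2)"
    by (simp add: sum_distrib_left distrib_left sum.distrib mult.left_commute)
  finally show ?thesis
    by (simp add: Gamma_unweighted_eq_sum_squares)
qed

text \<open>
  The two-point inequality summed over the edges at \<open>x\<close>. As \<open>\<I>' = - \<Phi>\<inverse>\<close>, the
  second factor on the right is \<open>L (\<I> g) - \<I>' (g) L g\<close>.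
\<close>

lemma gaussian_profile_generator_defect:
  assumes "\<forall>i. \<forall>x\<in>cube. 0 \<le> q i x" and x: "x \<in> cube"
    and g: "\<And>y. y \<in> cube \<Longrightarrow> 0 < g y \<and> g y < 1"
  shows "- 2 * Gamma_unweighted q g x \<le> gaussian_profile (g x) *
    (generator q (\<lambda>y. gaussian_profile (g y)) x + inv std_normal_cdf (g x) * generator q g x)"
proof -
  let ?I = gaussian_profile
  have "0 \<le> (\<Sum>i\<in>UNIV. q i x * (?I (g x) *
      (?I (g (flip i x)) - ?I (g x) + inv std_normal_cdf (g x) * (g (flip i x) - g x))
      + (g (flip i x) - g x)\<^sup>2))"
    using assms(1) x g[OF x] g[OF flip_in_cube[OF x]]
    by (intro sum_nonneg mult_nonneg_nonneg gaussian_profile_two_point) auto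
  also have "\<dots> = ?I (g x) * (generator q (\<lambda>y. ?I (g y)) x + inv std_normal_cdf (g x) * generator q g x)
      + 2 * Gamma_unweighted q g x"
  proof -
    have "2 * Gamma_unweighted q g x = (\<Sum>i\<in>UNIV. q i x * (g (flip i x) - g x)\<^sup>2)"
      by (simp add: Gamma_unweighted_eq_sum_squares)
    then show ?thesis
      unfolding generator_def
      by (simp add: sum_distrib_left distrib_left sum.distrib mult.left_commute)
  qed
  finally show ?thesis by simp
qed

text \<open>
  The pointwise inequality behind the monotonicity of the interpolation. Write \<open>N\<close> for the numerator of the
  fraction. Multiplying by \<open>2 F\<close> and expanding \<open>L (F\<^sup>2) = L (\<I> (g)\<^sup>2) + c L (\<Gamma>\<^sub>w g)\<close> with the square rule gives
  \<open>2 F L F + N = 2 \<I> (L \<I> (g) - \<I>' (g) L g) + 2 \<Gamma> (\<I> (g)) - 2 \<Gamma> F + 2 c \<Gamma>\<^sub>2\<^sub>;\<^sub>w g + c' \<Gamma>\<^sub>w g\<close>.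
  The bound on \<open>\<Gamma> F\<close> costs \<open>\<Gamma> (\<I> (g)) + c \<Gamma> (sqrt (\<Gamma>\<^sub>w g))\<close>. The first part cancels, and the second
  is exactly what the reinforced condition yields on top of \<open>\<rho> \<Gamma>\<^sub>w g\<close>. The two-point inequality costs
  \<open>4 \<Gamma> g \<le> (4 / b) \<Gamma>\<^sub>w g\<close>, and \<open>c' + 2 \<rho> c = 4 / b\<close> pays for it.
\<close>

lemma interpolation_derivative_nonneg:
  fixes q w g b \<rho> c c'
  defines "F \<equiv> \<lambda>y. sqrt ((gaussian_profile (g y))\<^sup>2 + c * Gamma_w q w g y)"
  assumes q: "\<forall>i. \<forall>x\<in>cube. 0 \<le> q i x" and b: "0 < b" and w: "bounded_weights b w"
    and BE: "reinforced_Bakry_Emery q w \<rho>"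
    and c: "0 \<le> c" "c' = 4 / b - 2 * \<rho> * c"
    and g: "\<And>y. y \<in> cube \<Longrightarrow> 0 < g y \<and> g y < 1" and x: "x \<in> cube"
  shows "0 \<le> generator q F x +
    (2 * gaussian_profile (g x) * inv std_normal_cdf (g x) * generator q g x
      + c' * Gamma_w q w g x - 2 * c * carre_du_champ q w g (generator q g) x) / (2 * F x)"
proof -
  let ?I = "\<lambda>y. gaussian_profile (g y)" and ?z = "inv std_normal_cdf (g x)"
  let ?G = "Gamma_w q w g" and ?L = "generator q" and ?\<Gamma> = "Gamma_unweighted q"
  let ?C = "carre_du_champ q w g (?L g) x"
  have G0: "0 \<le> ?G y" if "y \<in> cube" for y
    using Gamma_w_nonneg[OF q b w that] .
  have F0: "0 < F x"
    unfolding F_def using c G0[OF x] gaussian_profile_pos[of "g x"] g[OF x] by (simp add: add_pos_nonneg)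
  have "2 * F x * ?L F x + 2 * ?\<Gamma> F x = ?L (\<lambda>y. (F y)\<^sup>2) x"
    by (rule generator_square[symmetric])
  also have "\<dots> = ?L (\<lambda>y. (?I y)\<^sup>2 + c * ?G y) x"
    using generator_pow_cong_cube[where q = q and k = 1
        and f = "\<lambda>y. (F y)\<^sup>2" and g = "\<lambda>y. (?I y)\<^sup>2 + c * ?G y", OF _ x] c G0
    by (simp add: F_def)
  also have "\<dots> = ?L (\<lambda>y. (?I y)\<^sup>2) x + c * ?L ?G x"
    by (simp add: generator_def sum_distrib_left flip: sum.distrib) (simp add: algebra_simps)
  also have "?L (\<lambda>y. (?I y)\<^sup>2) x = 2 * ?I x * ?L ?I x + 2 * ?\<Gamma> ?I x"
    by (rule generator_square)
  finally have LF: "2 * F x * ?L F x = 2 * (?I x * ?L ?I x) + 2 * ?\<Gamma> ?I x + c * ?L ?G x - 2 * ?\<Gamma> F x"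
    by simp
  have \<Gamma>F: "?\<Gamma> F x \<le> ?\<Gamma> ?I x + c * ?\<Gamma> (\<lambda>y. sqrt (?G y)) x"
    unfolding F_def by (rule Gamma_sqrt_sum_le[OF q c(1) x G0])
  have "\<rho> * ?G x \<le> 1 / 2 * ?L ?G x - ?C - ?\<Gamma> (\<lambda>y. sqrt (?G y)) x"
    using BE x unfolding reinforced_Bakry_Emery_def Gamma2_w_def by auto
  then have BE': "c * (\<rho> * ?G x) \<le> c * (1 / 2 * ?L ?G x - ?C - ?\<Gamma> (\<lambda>y. sqrt (?G y)) x)"
    using c(1) by (rule mult_left_mono)
  have def: "- 2 * ?\<Gamma> g x \<le> ?I x * (?L ?I x + ?z * ?L g x)"
    by (rule gaussian_profile_generator_defect[OF q x g])
  have "?\<Gamma> g x \<le> ?G x / b"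
    using Gamma_unweighted_le_Gamma_w[OF q w x] b by (simp add: pos_le_divide_eq mult.commute)
  moreover have "c' * ?G x = 4 * (?G x / b) - 2 * (c * (\<rho> * ?G x))"
    unfolding c(2) by (simp add: algebra_simps)
  ultimately have "0 \<le> 2 * F x * ?L F x + (2 * ?I x * ?z * ?L g x + c' * ?G x - 2 * c * ?C)"
    using \<Gamma>F BE' def unfolding LF by (simp add: algebra_simps)
  then have "0 \<le> (2 * F x * ?L F x + (2 * ?I x * ?z * ?L g x + c' * ?G x - 2 * c * ?C)) / (2 * F x)"
    using F0 by simp
  then show ?thesis using F0 by (simp add: add_divide_distrib)
qed

lemma Gamma_w_has_derivative:
  assumes x: "x \<in> cube"
    and G: "\<And>y. y \<in> cube \<Longrightarrow> ((\<lambda>s. G s y) has_real_derivative D y) (at s)"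
  shows "((\<lambda>s. Gamma_w q w (G s) x) has_real_derivative 2 * carre_du_champ q w (G s) D x) (at s)"
proof -
  have "((\<lambda>s. 1 / 2 * (\<Sum>i\<in>UNIV. w i x * q i x * (G s (flip i x) - G s x) * (G s (flip i x) - G s x)))
     has_real_derivative 1 / 2 * (\<Sum>i\<in>UNIV. 2 * (w i x * q i x * (G s (flip i x) - G s x) * (D (flip i x) - D x)))) (at s)"
    by (intro DERIV_cmult DERIV_sum)
       (auto intro!: derivative_eq_intros G x flip_in_cube simp: algebra_simps)
  then show ?thesis
    by (simp add: Gamma_w_def carre_du_champ_def flip: sum_distrib_left)
qed

text \<open>
  The coefficient solves \<open>\<gamma>' + 2 \<rho> \<gamma> = 4 / b\<close> with \<open>\<gamma> 0 = 0\<close>; this equation, the one demanded by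
  the pointwise inequality above, is the reason for its formula.
\<close>

lemma gamma_coeff_ode:
  "b \<noteq> 0 \<Longrightarrow> (gamma_coeff b \<rho> has_real_derivative 4 / b - 2 * \<rho> * gamma_coeff b \<rho> s) (at s)"
  unfolding gamma_coeff_def[abs_def]
  by (cases "\<rho> = 0") (auto intro!: derivative_eq_intros simp: field_simps)

lemma gamma_coeff_nonneg:
  assumes "0 < b" "0 \<le> s"
  shows "0 \<le> gamma_coeff b \<rho> s"
proof (cases \<rho> "0 :: real" rule: linorder_cases)
  case less
  then have "1 \<le> exp (- 2 * \<rho> * s)" using assms by (simp add: mult_nonpos_nonneg)
  then show ?thesis using less assms by (simp add: gamma_coeff_def zero_le_divide_iff mult_nonneg_nonpos)
next
  case greater
  then have "exp (- 2 * \<rho> * s) \<le> 1" using assms by simp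
  then show ?thesis using greater assms by (simp add: gamma_coeff_def)
qed (use assms in \<open>simp add: gamma_coeff_def\<close>)

section \<open>The interpolation\<close>

text \<open>
  For \<open>f\<close> bounded away from \<open>0\<close> and \<open>1\<close> the function under the root stays positive along the
  interpolation, so that \<open>s \<mapsto> P\<^sub>s F\<^sub>s\<close> is differentiable and its monotonicity can be read off from the
  product rule. At \<open>s = 0\<close> it is the left-hand side, at \<open>s = t\<close> the right-hand side.
\<close>

lemma local_bobkov_interior:
  fixes q w :: "'n::finite \<Rightarrow> int ^ 'n \<Rightarrow> real"
  assumes q: "\<forall>i. \<forall>x\<in>cube. 0 \<le> q i x" and b: "0 < b" and w: "bounded_weights b w"
    and BE: "reinforced_Bakry_Emery q w \<rho>"
    and \<epsilon>: "0 < \<epsilon>" and f: "\<And>y. y \<in> cube \<Longrightarrow> \<epsilon> \<le> f y \<and> f y \<le> 1 - \<epsilon>"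
    and t: "0 \<le> t" and x: "x \<in> cube"
  shows "gaussian_profile (markov_semigroup q t f x)
    \<le> markov_semigroup q t
         (\<lambda>y. sqrt ((gaussian_profile (f y))\<^sup>2 + gamma_coeff b \<rho> t * Gamma_w q w f y)) x"
proof -
  define g where "g s = markov_semigroup q (t - s) f" for s
  define F where "F s y = sqrt ((gaussian_profile (g s y))\<^sup>2 + gamma_coeff b \<rho> s * Gamma_w q w (g s) y)" for s y
  \<comment> \<open>The derivative in \<open>s\<close> of the expression under the root in \<open>F s y\<close>; the signs come from
    \<open>\<partial>\<^sub>s g\<^sub>s = - L g\<^sub>s\<close> and \<open>\<I>' = - \<Phi>\<inverse>\<close>.\<close>
  define N where "N s y = 2 * gaussian_profile (g s y) * inv std_normal_cdf (g s y) * generator q (g s) y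
      + (4 / b - 2 * \<rho> * gamma_coeff b \<rho> s) * Gamma_w q w (g s) y
      - 2 * gamma_coeff b \<rho> s * carre_du_champ q w (g s) (generator q (g s)) y" for s y
  have g01: "0 < g s y \<and> g s y < 1" if "s \<le> t" "y \<in> cube" for s y
  proof -
    have "0 \<le> markov_semigroup q (t - s) (\<lambda>y. 1 * f y + - \<epsilon>) y"
      "0 \<le> markov_semigroup q (t - s) (\<lambda>y. - 1 * f y + (1 - \<epsilon>)) y"
      using that f by (auto intro!: markov_semigroup_nonneg[OF q])
    then show ?thesis
      unfolding markov_semigroup_affine[OF that(2)] g_def using \<epsilon> by linarith
  qed
  have g': "((\<lambda>s. g s y) has_real_derivative - generator q (g s) y) (at s)" if "y \<in> cube" for s y
  proof -
    have "((\<lambda>s. t - s) has_real_derivative - 1) (at s)" by (auto intro!: derivative_eq_intros)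
    from DERIV_chain2[OF markov_semigroup_has_derivative[OF that] this] show ?thesis
      by (simp add: g_def)
  qed
  have F': "((\<lambda>s. F s y) has_real_derivative N s y / (2 * F s y)) (at s)"
    if s: "0 \<le> s" "s \<le> t" and y: "y \<in> cube" for s y
  proof -
    let ?A = "\<lambda>s. (gaussian_profile (g s y))\<^sup>2 + gamma_coeff b \<rho> s * Gamma_w q w (g s) y"
    have A_pos: "0 < ?A s"
      using gaussian_profile_pos[of "g s y"] g01[OF s(2) y] gamma_coeff_nonneg[OF b s(1)]
        Gamma_w_nonneg[OF q b w y]
      by (simp add: add_pos_nonneg)
    have A': "(?A has_real_derivative N s y) (at s)"
    proof -
      have "((\<lambda>s. gaussian_profile (g s y)) has_real_derivative
          - inv std_normal_cdf (g s y) * - generator q (g s) y) (at s)"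
        using g01[OF s(2) y] by (intro DERIV_chain2[OF gaussian_profile_deriv g'[OF y]]) auto
      note I' = DERIV_power[OF this, of 2]
      have neg: "carre_du_champ q w (g s) (\<lambda>z. - generator q (g s) z) y
          = - carre_du_champ q w (g s) (generator q (g s)) y"
        by (simp add: carre_du_champ_def algebra_simps flip: sum_negf)
      note G' = Gamma_w_has_derivative[where q = q and w = w and s = s, OF y g']
      show ?thesis
        using b by (auto intro!: DERIV_cong[OF DERIV_add[OF I' DERIV_mult[OF gamma_coeff_ode G']]]
            simp: N_def neg algebra_simps)
    qed
    have "((\<lambda>s. sqrt (?A s)) has_real_derivative inverse (sqrt (?A s)) / 2 * N s y) (at s)"
      by (rule DERIV_chain2[where g = ?A, OF DERIV_real_sqrt[OF A_pos] A'])
    then show ?thesis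
      unfolding F_def by (rule DERIV_cong) (use A_pos in \<open>simp add: inverse_eq_divide\<close>)
  qed
  have "markov_semigroup q 0 (F 0) x \<le> markov_semigroup q t (F t) x"
  proof (rule DERIV_nonneg_imp_nondecreasing[OF t])
    fix s assume s: "0 \<le> s" "s \<le> t"
    have "0 \<le> generator q (F s) y + N s y / (2 * F s y)" if "y \<in> cube" for y
      using interpolation_derivative_nonneg[OF q b w BE gamma_coeff_nonneg[OF b s(1)] refl g01[OF s(2)] that]
      by (simp add: F_def[abs_def] N_def)
    then have "0 \<le> markov_semigroup q s (\<lambda>y. generator q (F s) y + N s y / (2 * F s y)) x"
      by (intro markov_semigroup_nonneg[OF q s(1)] x)
    moreover have "((\<lambda>s. markov_semigroup q s (F s) x) has_real_derivative
        markov_semigroup q s (\<lambda>y. generator q (F s) y + N s y / (2 * F s y)) x) (at s)"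
      by (intro markov_semigroup_has_derivative_moving[OF x] F' s)
    ultimately show "\<exists>D. ((\<lambda>s. markov_semigroup q s (F s) x) has_real_derivative D) (at s) \<and> 0 \<le> D"
      by blast
  qed
  moreover have "F 0 x = gaussian_profile (markov_semigroup q t f x)"
    by (simp add: F_def g_def gamma_coeff_def gaussian_profile_nonneg)
  moreover have "g t = f" by (simp add: g_def fun_eq_iff)
  ultimately show ?thesis by (simp add: F_def[abs_def])
qed

theorem theorem5p1:
  fixes \<mu> :: "(int ^ 'n::finite) pmf"
    and q w :: "'n \<Rightarrow> int ^ 'n \<Rightarrow> real"
    and b \<rho> t :: real
    and f :: "int ^ 'n \<Rightarrow> real"
  assumes "set_pmf \<mu> \<subseteq> cube"
    and "\<forall>i. \<forall>x\<in>cube. 0 \<le> q i x"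
    and "reversible \<mu> q"
    and "0 < b" and "b \<le> 1"
    and "bounded_weights b w"
    and "reinforced_Bakry_Emery q w \<rho>"
    and "\<forall>x\<in>cube. f x \<in> {0..1}"
    and "0 \<le> t"
  shows "\<forall>x\<in>cube. gaussian_profile (markov_semigroup q t f x)
    \<le> markov_semigroup q t
         (\<lambda>y. sqrt ((gaussian_profile (f y))\<^sup>2 + gamma_coeff b \<rho> t * Gamma_w q w f y)) x"
proof
  fix x :: "int ^ 'n" assume x: "x \<in> cube"
  \<comment> \<open>Contract \<open>f\<close> towards \<open>1 / 2\<close>, apply the interior case, and let \<open>\<epsilon>\<close> tend to \<open>0\<close>. An affine
    contraction commutes with \<open>P\<^sub>t\<close> and rescales \<open>\<Gamma>\<^sub>w\<close> by a constant factor.\<close>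
  define h where "h \<epsilon> y = (1 - 2 * \<epsilon>) * f y + \<epsilon>" for \<epsilon> y
  let ?R = "\<lambda>\<epsilon> y. sqrt ((gaussian_profile (h \<epsilon> y))\<^sup>2 + gamma_coeff b \<rho> t * ((1 - 2 * \<epsilon>)\<^sup>2 * Gamma_w q w f y))"
  have Gamma_h: "Gamma_w q w (h \<epsilon>) y = (1 - 2 * \<epsilon>)\<^sup>2 * Gamma_w q w f y" for \<epsilon> y
  proof -
    have "h \<epsilon> z - h \<epsilon> y = (1 - 2 * \<epsilon>) * (f z - f y)" for z
      by (simp add: h_def algebra_simps)
    then show ?thesis
      by (simp add: Gamma_w_def carre_du_champ_def sum_distrib_left power2_eq_square mult_ac)
  qed
  have le: "gaussian_profile ((1 - 2 * \<epsilon>) * markov_semigroup q t f x + \<epsilon>)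
      \<le> (\<Sum>y\<in>cube. ?R \<epsilon> y * markov_semigroup q t (indicator {y}) x)"
    if "0 < \<epsilon>" "\<epsilon> < 1 / 2" for \<epsilon>
  proof -
    have h: "\<epsilon> \<le> h \<epsilon> y \<and> h \<epsilon> y \<le> 1 - \<epsilon>" if "y \<in> cube" for y
    proof -
      have "0 \<le> (1 - 2 * \<epsilon>) * f y" "(1 - 2 * \<epsilon>) * f y \<le> 1 - 2 * \<epsilon>"
        using assms(8) that \<open>\<epsilon> < 1 / 2\<close> by (auto intro: mult_left_le)
      then show ?thesis by (simp add: h_def)
    qed
    have "gaussian_profile (markov_semigroup q t (h \<epsilon>) x) \<le> markov_semigroup q t (?R \<epsilon>) x"
      using local_bobkov_interior[where f = "h \<epsilon>", OF assms(2,4,6,7) that(1) h assms(9) x]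
      by (simp add: Gamma_h)
    moreover have "markov_semigroup q t (h \<epsilon>) x = (1 - 2 * \<epsilon>) * markov_semigroup q t f x + \<epsilon>"
      unfolding h_def by (rule markov_semigroup_affine[OF x])
    ultimately show ?thesis
      using markov_semigroup_kernel[OF x, of q t "?R \<epsilon>"] by simp
  qed
  have id: "((\<lambda>\<epsilon>::real. \<epsilon>) \<longlongrightarrow> 0) (at_right 0)" by (rule tendsto_ident_at)
  have h0: "((\<lambda>\<epsilon>. (1 - 2 * \<epsilon>) * a + \<epsilon>) \<longlongrightarrow> a) (at_right 0)" for a :: real
    by (rule tendsto_eq_intros id refl | simp)+
  have two: "((\<lambda>\<epsilon>. (1 - 2 * \<epsilon>)\<^sup>2) \<longlongrightarrow> (1 :: real)) (at_right 0)"
    by (rule tendsto_eq_intros id refl | simp)+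
  have "gaussian_profile (markov_semigroup q t f x)
      \<le> (\<Sum>y\<in>cube. sqrt ((gaussian_profile (f y))\<^sup>2 + gamma_coeff b \<rho> t * (1 * Gamma_w q w f y))
           * markov_semigroup q t (indicator {y}) x)"
  proof (rule tendsto_le)
    show "((\<lambda>\<epsilon>. gaussian_profile ((1 - 2 * \<epsilon>) * markov_semigroup q t f x + \<epsilon>))
        \<longlongrightarrow> gaussian_profile (markov_semigroup q t f x)) (at_right 0)"
      by (rule isCont_tendsto_compose[OF isCont_gaussian_profile h0])
    show "((\<lambda>\<epsilon>. \<Sum>y\<in>cube. ?R \<epsilon> y * markov_semigroup q t (indicator {y}) x)
        \<longlongrightarrow> (\<Sum>y\<in>cube. sqrt ((gaussian_profile (f y))\<^sup>2 + gamma_coeff b \<rho> t * (1 * Gamma_w q w f y))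
           * markov_semigroup q t (indicator {y}) x)) (at_right 0)"
      unfolding h_def
      by (intro tendsto_intros two isCont_tendsto_compose[OF isCont_gaussian_profile h0])
    show "\<forall>\<^sub>F \<epsilon> in at_right 0. gaussian_profile ((1 - 2 * \<epsilon>) * markov_semigroup q t f x + \<epsilon>)
        \<le> (\<Sum>y\<in>cube. ?R \<epsilon> y * markov_semigroup q t (indicator {y}) x)"
      unfolding eventually_at_right_field using le by (intro exI[of _ "1 / 2"]) auto
  qed simp
  then show "gaussian_profile (markov_semigroup q t f x)
    \<le> markov_semigroup q t
         (\<lambda>y. sqrt ((gaussian_profile (f y))\<^sup>2 + gamma_coeff b \<rho> t * Gamma_w q w f y)) x"
    by (subst markov_semigroup_kernel[OF x, of q t "\<lambda>y. sqrt (_ y)"]) simp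
qed

end
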